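(* Let $(X,\tau,\mathcal{I})$ be an ideal topological space, $(Y,\sigma)$ a topological space, and $f:(X,\tau,\mathcal{I})\to(Y,\sigma)$ a function. If $f$ is continuous (with respect to $\tau$ and $\sigma$), then it is also $\sharp$-continuous.
   Context: An ideal on a set $X$ is a non-empty family $\mathcal{I}\subseteq 2^X$ ($2^X$ is the power set of $X$) closed under taking subsets and finite unions. An ideal topological space $(X,\tau,\mathcal{I})$ is a topological space $(X,\tau)$ together with an ideal $\mathcal{I}$ on $X$. $\tau(x)$ denotes the collection of all open sets containing $x$, and $S^c=X\setminus S$. The sharp function of $A\subseteq X$ is $A^\sharp=\{x\in X\mid(\forall U\in\tau(x))(\exists I\in\mathcal{I}\setminus\{\emptyset\})(I\cap(U\cap A)^c=\emptyset)\}$; put $cl^\sharp(A)=A\cup A^\sharp$ and let $\tau^\sharp=\{A\subseteq X\mid cl^\sharp(X\setminus A)=X\setminus A\}$ (the $\sharp$-topology). The function $f$ is $\sharp$-continuous if $f^{-1}[V]\in\tau^\sharp$ for each open set $V$ of $Y$. *)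

theory Defs
  imports "HOL-Analysis.Analysis"
begin

text \<open>
  The space \<open>(X, \<tau>)\<close> is an abstract topology \<open>X\<close>, with underlying set \<open>topspace X\<close> and
  \<open>\<tau>\<close> given by \<open>openin X\<close>; complements are taken in \<open>topspace X\<close>. The definitions of
  \<open>sharp\<close> and \<open>cl_sharp\<close> are meant for \<open>A \<subseteq> topspace X\<close>.
\<close>

definition ideal_on :: "'a set \<Rightarrow> 'a set set \<Rightarrow> bool" where
  "ideal_on S \<I> \<longleftrightarrow>
     \<I> \<subseteq> Pow S \<and> \<I> \<noteq> {} \<and>
     (\<forall>A\<in>\<I>. \<forall>B. B \<subseteq> A \<longrightarrow> B \<in> \<I>) \<and>
     (\<forall>A\<in>\<I>. \<forall>B\<in>\<I>. A \<union> B \<in> \<I>)"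

definition sharp :: "'a topology \<Rightarrow> 'a set set \<Rightarrow> 'a set \<Rightarrow> 'a set" where
  "sharp X \<I> A =
     {x \<in> topspace X. \<forall>U. openin X U \<and> x \<in> U \<longrightarrow>
        (\<exists>I \<in> \<I> - {{}}. I \<inter> (topspace X - U \<inter> A) = {})}"

definition cl_sharp :: "'a topology \<Rightarrow> 'a set set \<Rightarrow> 'a set \<Rightarrow> 'a set" where
  "cl_sharp X \<I> A = A \<union> sharp X \<I> A"

text \<open>The \<open>\<sharp>\<close>-topology is given as its family of open sets.\<close>

definition sharp_topology :: "'a topology \<Rightarrow> 'a set set \<Rightarrow> 'a set set" where
  "sharp_topology X \<I> =
     {A. A \<subseteq> topspace X \<and> cl_sharp X \<I> (topspace X - A) = topspace X - A}"

text \<open>As in \<open>continuous_map\<close>, being a function between the underlying sets is part of the notion.\<close>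

definition sharp_continuous_map ::
  "'a topology \<Rightarrow> 'a set set \<Rightarrow> 'b topology \<Rightarrow> ('a \<Rightarrow> 'b) \<Rightarrow> bool" where
  "sharp_continuous_map X \<I> Y f \<longleftrightarrow>
     f \<in> topspace X \<rightarrow> topspace Y \<and>
     (\<forall>V. openin Y V \<longrightarrow> {x \<in> topspace X. f x \<in> V} \<in> sharp_topology X \<I>)"

end

theory Submission
  imports Defs
begin

text \<open>
  The \<open>\<sharp>\<close>-topology is finer than \<open>\<tau>\<close>, so preimages that are open in \<open>\<tau>\<close> are
  \<open>\<sharp>\<close>-open and continuity passes over. The reason is that a non-empty member of the
  ideal inside \<open>U \<inter> A\<close> witnesses in particular that \<open>U\<close> meets \<open>A\<close>; hence
  \<open>A\<^sup>\<sharp>\<close> lies in the ordinary closure of \<open>A\<close> (\<open>sharp_subset_closure_of\<close>), and a closed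
  set is its own \<open>\<sharp>\<close>-closure. Taking complements shows that open sets are
  \<open>\<sharp>\<close>-open (\<open>openin_imp_sharp_open\<close>).
\<close>

text \<open>
  The ideal has to consist of subsets of the space: only then does a member that misses
  the complement of \<open>U \<inter> A\<close> provide a point of \<open>U \<inter> A\<close>.
\<close>

lemma sharp_subset_closure_of:
  assumes "\<I> \<subseteq> Pow (topspace X)"
  shows "sharp X \<I> A \<subseteq> X closure_of A"
proof
  fix x assume x: "x \<in> sharp X \<I> A"
  have "\<exists>y. y \<in> A \<and> y \<in> U" if U: "x \<in> U \<and> openin X U" for U
  proof -
    obtain I where "I \<in> \<I>" "I \<noteq> {}" "I \<inter> (topspace X - U \<inter> A) = {}"
      using x U unfolding sharp_def by blast
    with assms show ?thesis by blast
  qed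
  moreover have "x \<in> topspace X"
    using x by (simp add: sharp_def)
  ultimately show "x \<in> X closure_of A"
    by (simp add: in_closure_of)
qed

lemma cl_sharp_closedin:
  assumes "\<I> \<subseteq> Pow (topspace X)" and "closedin X C"
  shows "cl_sharp X \<I> C = C"
  using sharp_subset_closure_of[OF assms(1), of C] closure_of_closedin[OF assms(2)]
  by (auto simp: cl_sharp_def)

lemma openin_imp_sharp_open:
  assumes "\<I> \<subseteq> Pow (topspace X)" and "openin X U"
  shows "U \<in> sharp_topology X \<I>"
  using cl_sharp_closedin[OF assms(1), of "topspace X - U"] assms(2)
  by (simp add: sharp_topology_def openin_closedin_eq)

theorem corollary7p5:
  fixes X :: "'a topology" and \<I> :: "'a set set"
    and Y :: "'b topology" and f :: "'a \<Rightarrow> 'b"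
  assumes "ideal_on (topspace X) \<I>"
    and "f \<in> topspace X \<rightarrow> topspace Y"
    and "continuous_map X Y f"
  shows "sharp_continuous_map X \<I> Y f"
proof -
  have "\<I> \<subseteq> Pow (topspace X)"
    using assms(1) by (simp add: ideal_on_def)
  then have "{x \<in> topspace X. f x \<in> V} \<in> sharp_topology X \<I>" if "openin Y V" for V
    using openin_continuous_map_preimage[OF assms(3) that] by (rule openin_imp_sharp_open)
  with assms(2) show ?thesis
    by (simp add: sharp_continuous_map_def)
qed

end
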